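(* Let $A\in\mathbb{R}^{m\times n}$, $A\ne 0$, and $B\in\mathbb{R}^{m\times p}$ (the equation $AX=B$ may be inconsistent). Let $X^{(0)}\in\mathbb{R}^{n\times p}$ be arbitrary, $R^{(0)}=B-AX^{(0)}$, and for $k\ge 0$ let $$W^{(k)}=\frac{(A_{:,j})^TR^{(k)}}{\|A_{:,j}\|_2^2},\qquad X^{(k+1)}_{j,:}=X^{(k)}_{j,:}+W^{(k)},\qquad R^{(k+1)}=R^{(k)}-A_{:,j}W^{(k)},$$ (all rows of $X^{(k)}$ other than the $j$th being left unchanged), where at each iteration the column index $j\in\{1,\dots,n\}$ is selected at random with probability $\|A_{:,j}\|_2^2/\|A\|_F^2$. Then, in exact arithmetic, for all $k\ge 0$ $$E\bigl[\|A(X^{(k)}-A^+B)\|_F^2\bigr]\le\left(1-\frac{\sigma_{\min}^2(A)}{\|A\|_F^2}\right)^k\|A(X^{(0)}-A^+B)\|_F^2 .$$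
   Context: $A_{:,j}$ denotes the $j$th column of $A$, $X_{j,:}$ the $j$th row of $X$, $A^+$ the Moore-Penrose inverse, $\|\cdot\|_F$ the Frobenius norm, and $\sigma_{\min}(A)$ the smallest nonzero singular value of $A$. The index selections at different iterations are independent; zero columns have probability zero and are never selected. *)

theory Defs
  imports "HOL-Probability.Probability"
begin

text \<open>
  The type class norm of \<^typ>\<open>real^'n^'m\<close> is the Euclidean norm of the vector of row norms,
  i.e. the Frobenius norm; it is used as such throughout.
\<close>

lemma norm_matrix_eq_frobenius:
  fixes A :: "real^'n^'m"
  shows "norm A = sqrt (\<Sum>i\<in>UNIV. \<Sum>j\<in>UNIV. (A $ i $ j)\<^sup>2)"
  by (simp add: norm_vec_def L2_set_def sum_nonneg)

definition moore_penrose :: "real^'n^'m \<Rightarrow> real^'m^'n \<Rightarrow> bool" where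
  "moore_penrose A P \<longleftrightarrow>
     A ** P ** A = A \<and> P ** A ** P = P \<and>
     transpose (A ** P) = A ** P \<and> transpose (P ** A) = P ** A"

definition pinv :: "real^'n^'m \<Rightarrow> real^'m^'n" where
  "pinv A = (THE P. moore_penrose A P)"

text \<open>
  Singular values are the nonnegative square roots of the eigenvalues of $A^T A$.  If $A$ has fewer
  rows than columns this includes zeros that are omitted under other conventions; the nonzero
  singular values do not depend on the convention.
\<close>

definition singular_values :: "real^'n^'m \<Rightarrow> real set" where
  "singular_values A =
     {\<sigma>. 0 \<le> \<sigma> \<and> (\<exists>v. v \<noteq> 0 \<and> (transpose A ** A) *v v = \<sigma>\<^sup>2 *\<^sub>R v)}"

definition sigma_min :: "real^'n^'m \<Rightarrow> real" where
  "sigma_min A = Min {\<sigma> \<in> singular_values A. \<sigma> \<noteq> 0}"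

definition outer_prod :: "real^'m \<Rightarrow> real^'p \<Rightarrow> real^'p^'m" where
  "outer_prod u w = (\<chi> i l. u $ i * w $ l)"

end

theory Submission
  imports Defs
begin

text \<open>
  Since $A^T A A^+ = A^T$, the component of the residual orthogonal to the range of $A$ is annihilated
  by every $A_{:,j}^T$, so $D = A(X - A^+B)$ evolves on its own: selecting $j$ removes from each column
  of $D$ its component along $A_{:,j}$.  Averaging the squared length of what is removed over $j$ gives
  exactly $\|A^T D\|_F^2 / \|A\|_F^2$, and $\|A^T D\|_F \ge \sigma_{\min}(A) \|D\|_F$ because the columns
  of $D$ lie in the range of $A$.  Independence of the selections turns this one-step contraction into
  the geometric bound.
\<close>

section \<open>Existence and uniqueness of the Moore-Penrose inverse\<close>

lemma symmetric_matrixI: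
  fixes M :: "real^'n^'n"
  assumes "\<And>x y. (M *v x) \<bullet> y = x \<bullet> (M *v y)"
  shows "transpose M = M"
proof -
  have "adjoint ((*v) M) = (*v) M"
    using assms by (intro adjoint_unique) auto
  then have "(*v) (transpose M) = (*v) M"
    by (metis adjoint_matrix)
  then show ?thesis
    by (metis matrix_eq)
qed

lemma inner_gram:
  fixes A :: "real^'n^'m"
  shows "x \<bullet> ((transpose A ** A) *v y) = (A *v x) \<bullet> (A *v y)"
  by (metis dot_lmul_matrix matrix_vector_mul_assoc transpose_transpose transpose_matrix_vector)

text \<open>\<open>A ** P\<close> and \<open>A ** Q\<close> are symmetric and absorb each other, so
  transposing their product swaps the factors and forces equality; likewise for
  \<open>P ** A\<close> and \<open>Q ** A\<close>. Then P = PAP = PAQ = QAQ = Q.\<close>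

lemma moore_penrose_unique:
  fixes A :: "real^'n^'m"
  assumes P: "moore_penrose A P" and Q: "moore_penrose A Q"
  shows "P = Q"
proof -
  note P = P[unfolded moore_penrose_def] and Q = Q[unfolded moore_penrose_def]
  have "A ** P = (A ** Q) ** (A ** P)"
    using Q by (metis matrix_mul_assoc)
  also have "\<dots> = transpose ((A ** P) ** (A ** Q))"
    using P Q by (simp add: matrix_transpose_mul)
  also have "\<dots> = A ** Q"
    using P Q by (metis matrix_mul_assoc)
  finally have 1: "A ** P = A ** Q" .
  have "P ** A = (P ** A) ** (Q ** A)"
    using Q by (metis matrix_mul_assoc)
  also have "\<dots> = transpose ((Q ** A) ** (P ** A))"
    using P Q by (simp add: matrix_transpose_mul)
  also have "\<dots> = Q ** A"
    using P Q by (metis matrix_mul_assoc)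
  finally have 2: "P ** A = Q ** A" .
  show ?thesis
    using P Q 1 2 by (metis matrix_mul_assoc)
qed

text \<open>Expansion in an orthonormal basis of \<open>S\<close> defines the projection. It is
  applied below to the kernel of \<open>A\<close>.\<close>

lemma symmetric_projection_onto_subspace_exists:
  fixes S :: "(real^'n) set"
  assumes "subspace S"
  obtains Q :: "real^'n^'n" where "transpose Q = Q" "\<And>x. Q *v x \<in> S" "\<And>x. x \<in> S \<Longrightarrow> Q *v x = x"
proof -
  obtain B where B: "B \<subseteq> S" "pairwise orthogonal B" "\<And>x. x \<in> B \<Longrightarrow> norm x = 1"
    "independent B" "span B = S"
    using orthonormal_basis_subspace[OF assms] by metis
  have fin: "finite B"
    using B(2) by (rule pairwise_orthogonal_imp_finite)
  define f where "f x = (\<Sum>b\<in>B. (b \<bullet> x) *\<^sub>R b)" for x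
  have lin: "linear f"
    unfolding f_def by (intro linearI) (auto simp: inner_add_right scaleR_add_left sum.distrib scaleR_sum_right)
  have f_basis: "f b = b" if "b \<in> B" for b
  proof -
    have "f b = (\<Sum>c\<in>B. if c = b then b else 0)"
      unfolding f_def using B(2,3) that
      by (intro sum.cong) (auto simp: pairwise_def orthogonal_def norm_eq_1)
    with fin that show ?thesis by simp
  qed
  have f_id: "f x = x" if "x \<in> S" for x
    using linear_eq_on_span[OF lin linear_id, of B x] f_basis that B(5) by simp
  have f_sym: "f x \<bullet> y = x \<bullet> f y" for x y
    unfolding f_def by (simp add: inner_sum_left inner_sum_right inner_commute mult.commute)
  have f_in: "f x \<in> S" for x
    unfolding f_def using B(1) assms by (auto intro!: subspace_sum subspace_scale)
  have mf: "matrix f *v x = f x" for x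
    using lin by (simp add: matrix_works)
  show ?thesis
    by (rule that[of "matrix f"]) (auto simp: mf f_id f_in f_sym intro!: symmetric_matrixI)
qed

text \<open>
  Adding the orthogonal projection $Q$ onto the kernel makes $A^T A$ invertible without changing it
  on the complement of the kernel, so that $A^+ = (A^T A + Q)^{-1} A^T$.
\<close>

lemma moore_penrose_exists:
  fixes A :: "real^'n^'m"
  shows "\<exists>P. moore_penrose A P"
proof -
  have "subspace {x. A *v x = 0}"
    by (rule linear_subspace_kernel) simp
  then obtain Q :: "real^'n^'n" where Q: "transpose Q = Q" "\<And>x. A *v (Q *v x) = 0"
      "\<And>x. A *v x = 0 \<Longrightarrow> Q *v x = x"
    using symmetric_projection_onto_subspace_exists[of "{x. A *v x = 0}"] by auto
  have AQ: "A ** Q = 0"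
    using Q(2) by (simp add: matrix_eq flip: matrix_vector_mul_assoc)
  have QQ: "Q ** Q = Q"
    using Q(2,3) by (simp add: matrix_eq flip: matrix_vector_mul_assoc)
  have QAt: "Q ** transpose A = 0"
  proof -
    have "Q ** transpose A = transpose (A ** Q)"
      by (simp add: matrix_transpose_mul Q(1))
    then show ?thesis
      by (simp add: AQ) (simp add: transpose_def vec_eq_iff)
  qed
  define G where "G = transpose A ** A + Q"
  have G_sym: "transpose G = G"
    using Q(1) by (simp add: G_def matrix_transpose_mul transpose_def vec_eq_iff)
       (simp add: matrix_matrix_mult_def mult.commute)
  \<comment> \<open>Applying \<open>Q\<close> to G x isolates the kernel part Q x, since Q A^T = 0;
    once that vanishes, x . G x is the squared norm of A x. So x lies in the kernel and equals Q x =
    0.\<close>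
  have "x = 0" if "G *v x = 0" for x
  proof -
    have "Q *v (G *v x) = Q *v x"
      by (simp add: G_def matrix_vector_mul_assoc matrix_add_ldistrib matrix_mul_assoc QAt QQ)
    with that have Qx: "Q *v x = 0" by simp
    have "x \<bullet> (G *v x) = (A *v x) \<bullet> (A *v x)"
      using Qx by (simp add: G_def matrix_vector_mult_add_rdistrib inner_add_right inner_gram del: transpose_matrix_vector)
    with that have "A *v x = 0" by simp
    with Q(3) Qx show ?thesis by simp
  qed
  then obtain H where HG: "H ** G = mat 1"
    using matrix_left_invertible_ker by blast
  then have GH: "G ** H = mat 1"
    using matrix_left_right_inverse by blast
  have H_sym: "transpose H = H"
  proof -
    have "transpose H ** G = mat 1"
      using arg_cong[OF GH, of transpose] G_sym by (simp add: matrix_transpose_mul)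
    then show ?thesis
      by (metis GH matrix_mul_assoc matrix_mul_lid matrix_mul_rid)
  qed
  have QG: "Q ** G = Q"
    by (simp add: G_def matrix_add_ldistrib matrix_mul_assoc QAt QQ)
  have QH: "Q ** H = Q"
    by (metis QG GH matrix_mul_assoc matrix_mul_rid)
  have HQ: "H ** Q = Q"
    using arg_cong[OF QH, of transpose] Q(1) H_sym by (simp add: matrix_transpose_mul)
  define P where "P = H ** transpose A"
  \<comment> \<open>This is H G = 1 expanded with H Q = Q: \<open>P ** A\<close> is the projection
    complementary to \<open>Q\<close>. Three Penrose identities follow from it; the symmetry of
    \<open>A ** P\<close> comes from that of \<open>H\<close>.\<close>
  have PAQ: "P ** A + Q = mat 1"
    using HG by (simp add: G_def P_def matrix_add_ldistrib HQ matrix_mul_assoc)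
  then have PA: "P ** A = mat 1 - Q"
    by (simp add: algebra_simps)
  have "A ** (P ** A) = A"
    using arg_cong[OF PAQ, of "(**) A"] by (simp add: matrix_add_ldistrib AQ)
  moreover have "Q ** P = 0"
    by (simp add: P_def matrix_mul_assoc QH QAt)
  then have "(P ** A) ** P = P"
    unfolding PA by (simp add: matrix_eq matrix_vector_mult_diff_rdistrib flip: matrix_vector_mul_assoc)
  moreover have "transpose (A ** P) = A ** P"
    by (simp add: P_def matrix_transpose_mul H_sym matrix_mul_assoc)
  moreover have "transpose (P ** A) = P ** A"
    using Q(1) unfolding PA by (simp add: transpose_def vec_eq_iff mat_def)
  ultimately show ?thesis
    unfolding moore_penrose_def by (metis matrix_mul_assoc)
qed

lemma moore_penrose_pinv: "moore_penrose A (pinv A)"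
  unfolding pinv_def using moore_penrose_exists moore_penrose_unique by (metis theI')

text \<open>The transpose of A A^+ A = A, by symmetry of A A^+. Hence A^+ B solves the normal
  equations even when AX = B is inconsistent.\<close>

lemma transpose_mult_pinv:
  "transpose A ** (A ** pinv A) = transpose A"
  using moore_penrose_pinv[of A] unfolding moore_penrose_def by (metis matrix_transpose_mul)

section \<open>Singular values and the lower bound given by the smallest nonzero one\<close>

text \<open>Eigenvectors of A^T A for distinct eigenvalues are orthogonal, and a pairwise orthogonal
  set is finite. Finiteness makes the \<open>Min\<close> in \<open>sigma_min\<close> a genuine
  minimum.\<close>

lemma finite_singular_values:
  fixes A :: "real^'n^'m"
  shows "finite (singular_values A)"
proof -
  have "\<forall>\<sigma>\<in>singular_values A. \<exists>v. v \<noteq> 0 \<and> (transpose A ** A) *v v = \<sigma>\<^sup>2 *\<^sub>R v"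
    by (auto simp: singular_values_def)
  then obtain v where v: "\<And>\<sigma>. \<sigma> \<in> singular_values A \<Longrightarrow> v \<sigma> \<noteq> 0"
      "\<And>\<sigma>. \<sigma> \<in> singular_values A \<Longrightarrow> (transpose A ** A) *v v \<sigma> = \<sigma>\<^sup>2 *\<^sub>R v \<sigma>"
    by metis
  have orth: "orthogonal (v \<sigma>) (v \<tau>)" if "\<sigma> \<in> singular_values A" "\<tau> \<in> singular_values A" "\<sigma> \<noteq> \<tau>" for \<sigma> \<tau>
  proof -
    have "\<tau>\<^sup>2 * (v \<sigma> \<bullet> v \<tau>) = \<sigma>\<^sup>2 * (v \<sigma> \<bullet> v \<tau>)"
      using inner_gram[of "v \<sigma>" A "v \<tau>"] inner_gram[of "v \<tau>" A "v \<sigma>"] v(2) that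
      by (simp add: inner_commute)
    moreover have "\<tau>\<^sup>2 \<noteq> \<sigma>\<^sup>2"
      using that by (auto simp: singular_values_def power2_eq_iff_nonneg)
    ultimately show ?thesis
      by (simp add: orthogonal_def)
  qed
  have "inj_on v (singular_values A)"
    using orth v(1) by (metis inj_onI orthogonal_self)
  moreover have "finite (v ` singular_values A)"
    using orth by (intro pairwise_orthogonal_imp_finite) (auto simp: pairwise_def)
  ultimately show ?thesis
    by (rule finite_imageD[rotated])
qed

text \<open>A derivative-free first-order condition: with a nonzero linear coefficient, a suitable
  move against its sign would make the expression negative.\<close>

lemma nonneg_quadratic_imp_linear_coeff_0:
  fixes b c :: real
  assumes "\<And>t. 0 \<le> 2 * t * b + t\<^sup>2 * c"
  shows "b = 0"
proof (rule ccontr)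
  assume "b \<noteq> 0"
  have "0 < 1 + \<bar>c\<bar>" by simp
  \<comment> \<open>This denominator lets the linear gain outweigh the quadratic term whatever the
    sign of \<open>c\<close>, leaving a negative multiple of t^2.\<close>
  define t where "t = - b / (1 + \<bar>c\<bar>)"
  have bt: "b = - t * (1 + \<bar>c\<bar>)"
    using \<open>0 < 1 + \<bar>c\<bar>\<close> by (simp add: t_def)
  with \<open>b \<noteq> 0\<close> have "t \<noteq> 0" by auto
  have "2 * t * b + t\<^sup>2 * c = t\<^sup>2 * (c - 2 * \<bar>c\<bar> - 2)"
    unfolding bt by (simp add: algebra_simps power2_eq_square)
  also have "\<dots> < 0"
    using \<open>t \<noteq> 0\<close> by (intro mult_pos_neg) auto
  finally show False
    using assms[of t] by simp
qed

text \<open>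
  The minimum of the Rayleigh quotient over the orthogonal complement of the kernel is attained at
  an eigenvector of $A^T A$, since that complement is invariant under $A^T A$.
\<close>

lemma singular_value_lower_bound_exists:
  fixes A :: "real^'n^'m"
  assumes "A \<noteq> 0"
  obtains \<sigma> where "\<sigma> \<in> singular_values A" "\<sigma> > 0"
    "\<And>y. \<sigma>\<^sup>2 * (norm (A *v y))\<^sup>2 \<le> (norm (transpose A *v (A *v y)))\<^sup>2"
proof -
  let ?T = "transpose A ** A"
  define S where "S = {x. \<forall>w. A *v w = 0 \<longrightarrow> x \<bullet> w = 0}"
  have sub: "subspace S"
    by (auto simp: S_def subspace_def inner_add_left)
  have T_in: "?T *v x \<in> S" for x
    using inner_gram[of _ A x] by (auto simp: S_def inner_commute)
  \<comment> \<open>The witness A^+ A y lies in \<open>S\<close> because A^+ A is symmetric and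
    kills the kernel of \<open>A\<close>.\<close>
  have decomp: "\<exists>z\<in>S. A *v z = A *v y" for y
  proof 
    have "A *v (pinv A *v (A *v y)) = A *v y"
      using moore_penrose_pinv[of A] by (simp add: moore_penrose_def matrix_vector_mul_assoc matrix_mul_assoc)
    then show "A *v (pinv A *v (A *v y)) = A *v y" .
    have sym: "transpose (pinv A ** A) = pinv A ** A"
      using moore_penrose_pinv[of A] by (simp add: moore_penrose_def)
    show "pinv A *v (A *v y) \<in> S"
      unfolding S_def
    proof safe
      fix w assume "A *v w = 0"
      have "((pinv A ** A) *v y) \<bullet> w = y \<bullet> ((pinv A ** A) *v w)"
        by (metis sym dot_lmul_matrix transpose_matrix_vector)
      with \<open>A *v w = 0\<close> show "(pinv A *v (A *v y)) \<bullet> w = 0"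
        by (simp flip: matrix_vector_mul_assoc)
    qed
  qed
  define K where "K = S \<inter> sphere 0 1"
  have "closed S"
    using sub by (rule closed_subspace)
  then have "compact K"
    unfolding K_def by (intro closed_Int_compact) auto
  obtain y where "A *v y \<noteq> 0"
    using assms by (auto simp: matrix_eq)
  with decomp obtain z where z: "z \<in> S" "A *v z \<noteq> 0" by metis
  then have "z \<noteq> 0" by auto
  have "z /\<^sub>R norm z \<in> K"
    using z \<open>z \<noteq> 0\<close> sub by (auto simp: K_def intro: subspace_scale)
  then have "K \<noteq> {}" by blast
  have "continuous_on K (\<lambda>x. norm (A *v x))"
    by (intro continuous_intros linear_continuous_on_compose[where g="\<lambda>x. A *v x"] linear_continuous_on) auto
  with \<open>compact K\<close> \<open>K \<noteq> {}\<close> obtain v where v: "v \<in> K" "\<And>x. x \<in> K \<Longrightarrow> norm (A *v v) \<le> norm (A *v x)"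
    using continuous_attains_inf[of K "\<lambda>x. norm (A *v x)"] by blast
  define \<sigma> where "\<sigma> = norm (A *v v)"
  have vS: "v \<in> S" "norm v = 1" using v(1) by (auto simp: K_def)
  \<comment> \<open>A vector of \<open>S\<close> in the kernel is orthogonal to itself, but
    \<open>v\<close> is a unit vector.\<close>
  have "A *v v \<noteq> 0"
    using vS by (auto simp: S_def)
  then have "\<sigma> > 0" by (simp add: \<sigma>_def)
  have lower: "\<sigma> * norm x \<le> norm (A *v x)" if "x \<in> S" for x
  proof (cases "x = 0")
    case False
    then have "x /\<^sub>R norm x \<in> K"
      using that sub by (auto simp: K_def intro: subspace_scale)
    from v(2)[OF this] have "\<sigma> \<le> norm (A *v x) / norm x"
      by (simp add: \<sigma>_def matrix_vector_mult_scaleR divide_inverse mult.commute)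
    with False show ?thesis by (simp add: field_simps)
  qed simp
  \<comment> \<open>Up to a factor 2 this is the gradient at \<open>v\<close> of ||Ax||^2 -
    \<sigma>^2 ||x||^2, which attains its minimum 0 over \<open>S\<close> there. As \<open>u\<close>
    lies in \<open>S\<close>, it is an admissible direction, and the first-order condition gives u .
    u = 0.\<close>
  define u where "u = ?T *v v - \<sigma>\<^sup>2 *\<^sub>R v"
  have "u \<in> S"
    unfolding u_def using sub T_in vS by (intro subspace_diff subspace_scale) auto
  have "u \<bullet> u = 0"
  proof (rule nonneg_quadratic_imp_linear_coeff_0)
    fix t :: real
    have "v + t *\<^sub>R u \<in> S"
      using sub vS \<open>u \<in> S\<close> by (intro subspace_add subspace_scale) auto
    from lower[OF this] have "(\<sigma> * norm (v + t *\<^sub>R u))\<^sup>2 \<le> (norm (A *v (v + t *\<^sub>R u)))\<^sup>2"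
      using \<open>\<sigma> > 0\<close> by (intro power_mono) auto
    then have "0 \<le> (A *v v + t *\<^sub>R (A *v u)) \<bullet> (A *v v + t *\<^sub>R (A *v u))
        - \<sigma>\<^sup>2 * ((v + t *\<^sub>R u) \<bullet> (v + t *\<^sub>R u))"
      by (simp add: power_mult_distrib power2_norm_eq_inner matrix_vector_mult_scaleR matrix_vector_right_distrib)
    also have "\<dots> = ((A *v v) \<bullet> (A *v v) - \<sigma>\<^sup>2 * (v \<bullet> v))
        + 2 * t * ((A *v u) \<bullet> (A *v v) - \<sigma>\<^sup>2 * (u \<bullet> v))
        + t\<^sup>2 * ((A *v u) \<bullet> (A *v u) - \<sigma>\<^sup>2 * (u \<bullet> u))"
      by (simp add: inner_add_left inner_add_right inner_commute algebra_simps power2_eq_square)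
    also have "(A *v v) \<bullet> (A *v v) - \<sigma>\<^sup>2 * (v \<bullet> v) = 0"
      using vS(2) by (simp add: \<sigma>_def power2_norm_eq_inner norm_eq_1)
    also have "(A *v u) \<bullet> (A *v v) - \<sigma>\<^sup>2 * (u \<bullet> v) = u \<bullet> (?T *v v - \<sigma>\<^sup>2 *\<^sub>R v)"
      by (simp add: inner_gram inner_diff_right)
    finally show "0 \<le> 2 * t * (u \<bullet> u) + t\<^sup>2 * ((A *v u) \<bullet> (A *v u) - \<sigma>\<^sup>2 * (u \<bullet> u))"
      unfolding u_def[symmetric] by simp
  qed
  then have "?T *v v = \<sigma>\<^sup>2 *\<^sub>R v"
    by (simp add: u_def)
  moreover have "v \<noteq> 0" using vS by auto
  ultimately have "\<sigma> \<in> singular_values A"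
    using \<open>\<sigma> > 0\<close> by (auto simp: singular_values_def)
  moreover have "\<sigma>\<^sup>2 * (norm (A *v y))\<^sup>2 \<le> (norm (transpose A *v (A *v y)))\<^sup>2" for y
  proof -
    obtain z where z: "z \<in> S" "A *v z = A *v y" using decomp by blast
    \<comment> \<open>Cauchy-Schwarz bounds ||Az||^2 by ||z|| ||A^T A z||; with \<sigma> ||z|| \<le>
      ||Az||, one factor ||Az|| cancels.\<close>
    have "norm (A *v z) * norm (A *v z) = z \<bullet> (?T *v z)"
      by (simp add: inner_gram power2_norm_eq_inner flip: power2_eq_square)
    also have "\<dots> \<le> norm z * norm (?T *v z)"
      by (rule norm_cauchy_schwarz)
    finally have "\<sigma> * (norm (A *v z) * norm (A *v z)) \<le> \<sigma> * (norm z * norm (?T *v z))"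
      using \<open>\<sigma> > 0\<close> by simp
    also have "\<dots> \<le> norm (A *v z) * norm (?T *v z)"
      using mult_right_mono[OF lower[OF z(1)], of "norm (?T *v z)"] by (simp add: mult.assoc)
    finally have "\<sigma> * norm (A *v z) \<le> norm (?T *v z)"
      by (cases "A *v z = 0") (auto simp: mult.left_commute[of \<sigma>])
    then have "(\<sigma> * norm (A *v z))\<^sup>2 \<le> (norm (?T *v z))\<^sup>2"
      using \<open>\<sigma> > 0\<close> by (intro power_mono) auto
    then show ?thesis
      by (simp add: power_mult_distrib z(2) flip: matrix_vector_mul_assoc)
  qed
  ultimately show ?thesis
    using that \<open>\<sigma> > 0\<close> by blast
qed

text \<open>The \<sigma> just constructed is itself a nonzero singular value, so the minimum lies
  between 0 and it, and squaring keeps the order.\<close>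

lemma sigma_min_bound:
  fixes A :: "real^'n^'m"
  assumes "A \<noteq> 0"
  shows "(sigma_min A)\<^sup>2 * (norm (A *v y))\<^sup>2 \<le> (norm (transpose A *v (A *v y)))\<^sup>2"
proof -
  obtain \<sigma> where \<sigma>: "\<sigma> \<in> singular_values A" "\<sigma> > 0"
    "\<And>y. \<sigma>\<^sup>2 * (norm (A *v y))\<^sup>2 \<le> (norm (transpose A *v (A *v y)))\<^sup>2"
    using singular_value_lower_bound_exists[OF assms] by blast
  let ?N = "{\<sigma> \<in> singular_values A. \<sigma> \<noteq> 0}"
  have fin: "finite ?N" and mem: "\<sigma> \<in> ?N"
    using \<sigma> finite_singular_values[of A] by auto
  have "sigma_min A \<in> ?N"
    unfolding sigma_min_def using fin mem by (intro Min_in) auto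
  then have "0 \<le> sigma_min A"
    by (simp add: singular_values_def)
  moreover have "sigma_min A \<le> \<sigma>"
    unfolding sigma_min_def using fin mem by (rule Min_le)
  ultimately have "(sigma_min A)\<^sup>2 * (norm (A *v y))\<^sup>2 \<le> \<sigma>\<^sup>2 * (norm (A *v y))\<^sup>2"
    by (intro mult_right_mono power_mono) auto
  with \<sigma>(3)[of y] show ?thesis by linarith
qed

section \<open>Averaging over independent random selections\<close>

lemma PiM_count_space_finite_type:
  "finite I \<Longrightarrow> PiM I (\<lambda>_. count_space (UNIV :: 'b::finite set)) = count_space (PiE I (\<lambda>_. UNIV))"
  by (intro count_space_PiM_finite) auto

text \<open>A finite history takes finitely many values, so every function of it is measurable and
  bounded, here by the sum of all its absolute values.\<close>

lemma (in prob_space) integrable_finite_history: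
  fixes J :: "'i \<Rightarrow> 'a \<Rightarrow> 'b::finite" and g :: "('i \<Rightarrow> 'b) \<Rightarrow> real"
  assumes J: "\<And>i. i \<in> I \<Longrightarrow> random_variable (count_space UNIV) (J i)" and I: "finite I"
  shows "integrable M (\<lambda>\<omega>. g (restrict (\<lambda>i. J i \<omega>) I))"
proof -
  let ?C = "PiE I (\<lambda>_. UNIV :: 'b set)" and ?H = "\<lambda>\<omega>. restrict (\<lambda>i. J i \<omega>) I"
  have C: "finite ?C"
    using I by (intro finite_PiE) auto
  have "random_variable (PiM I (\<lambda>_. count_space UNIV)) ?H"
    using J by (rule measurable_restrict)
  then have H: "random_variable (count_space ?C) ?H"
    by (simp only: PiM_count_space_finite_type[OF I])
  show ?thesis
  proof (rule integrable_const_bound[where B = "\<Sum>h\<in>?C. \<bar>g h\<bar>"])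
    have "\<bar>g (?H \<omega>)\<bar> \<le> (\<Sum>h\<in>?C. \<bar>g h\<bar>)" for \<omega>
      by (rule member_le_sum[where f = "\<lambda>h. \<bar>g h\<bar>"]) (use C in auto)
    then show "AE \<omega> in M. norm (g (?H \<omega>)) \<le> (\<Sum>h\<in>?C. \<bar>g h\<bar>)"
      by simp
  qed (rule measurable_compose[OF H], simp)
qed

text \<open>Conditioning on the past by hand: splitting on the value of \<open>J k\<close> produces
  indicators independent of the history, and each may be replaced by its probability.\<close>

lemma (in prob_space) expectation_independent_choice:
  fixes J :: "'i \<Rightarrow> 'a \<Rightarrow> 'b::finite" and f :: "'b \<Rightarrow> ('i \<Rightarrow> 'b) \<Rightarrow> real"
  assumes indep: "indep_vars (\<lambda>_. count_space UNIV) J UNIV"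
    and I: "finite I" "k \<notin> I"
  shows "expectation (\<lambda>\<omega>. f (J k \<omega>) (restrict (\<lambda>i. J i \<omega>) I))
       = expectation (\<lambda>\<omega>. \<Sum>j\<in>UNIV. prob {\<omega> \<in> space M. J k \<omega> = j} * f j (restrict (\<lambda>i. J i \<omega>) I))"
proof -
  define H where "H \<omega> = restrict (\<lambda>i. J i \<omega>) I" for \<omega>
  have J: "random_variable (count_space UNIV) (J i)" for i
    using indep by (simp add: indep_vars_def)
  have int: "integrable M (\<lambda>\<omega>. g (H \<omega>))" for g :: "('i \<Rightarrow> 'b) \<Rightarrow> real"
    unfolding H_def using J I(1) by (rule integrable_finite_history)
  have J_int: "integrable M (\<lambda>\<omega>. indicator {j} (J k \<omega>) :: real)" for j
    using integrable_finite_history[OF J, of "{k}" "\<lambda>h. indicator {j} (h k)"] by simp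
  have J_exp: "expectation (\<lambda>\<omega>. indicat_real {j} (J k \<omega>)) = prob {\<omega> \<in> space M. J k \<omega> = j}" for j
  proof -
    have "expectation (\<lambda>\<omega>. indicat_real {j} (J k \<omega>)) = expectation (indicator {\<omega> \<in> space M. J k \<omega> = j})"
      by (intro Bochner_Integration.integral_cong) (auto simp: indicator_def)
    moreover have "{\<omega> \<in> space M. J k \<omega> = j} \<inter> space M = {\<omega> \<in> space M. J k \<omega> = j}"
      by blast
    ultimately show ?thesis
      by simp
  qed
  \<comment> \<open>\<open>J k\<close> enters as a restriction to \<open>{k}\<close> because
    independence passes to restrictions to disjoint index sets.\<close>
  have "indep_var (PiM I (\<lambda>_. count_space UNIV)) H
          (PiM {k} (\<lambda>_. count_space UNIV)) (\<lambda>\<omega>. restrict (\<lambda>i. J i \<omega>) {k})"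
    unfolding H_def by (rule indep_var_restrict[OF indep]) (use I in auto)
  then have indep_H: "indep_var (count_space (PiE I (\<lambda>_. UNIV))) H
          (count_space (PiE {k} (\<lambda>_. UNIV))) (\<lambda>\<omega>. restrict (\<lambda>i. J i \<omega>) {k})"
    using I(1) by (simp add: PiM_count_space_finite_type)
  have indep_f: "indep_var borel (\<lambda>\<omega>. f j (H \<omega>)) borel (\<lambda>\<omega>. indicator {j} (J k \<omega>) :: real)" for j
    using indep_var_compose[OF indep_H, of "f j" borel "\<lambda>h. indicator {j} (h k)" borel]
    by (simp add: comp_def)
  have "expectation (\<lambda>\<omega>. f (J k \<omega>) (H \<omega>))
      = expectation (\<lambda>\<omega>. \<Sum>j\<in>UNIV. f j (H \<omega>) * indicator {j} (J k \<omega>))"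
    by (intro Bochner_Integration.integral_cong) (auto simp: indicator_def if_distrib cong: if_cong)
  also have "\<dots> = (\<Sum>j\<in>UNIV. expectation (\<lambda>\<omega>. f j (H \<omega>) * indicator {j} (J k \<omega>)))"
    using indep_var_integrable[OF indep_f int J_int] by (intro Bochner_Integration.integral_sum)
  also have "\<dots> = (\<Sum>j\<in>UNIV. expectation (\<lambda>\<omega>. prob {\<omega> \<in> space M. J k \<omega> = j} * f j (H \<omega>)))"
    by (simp add: indep_var_lebesgue_integral[OF indep_f int J_int] J_exp mult.commute)
  also have "\<dots> = expectation (\<lambda>\<omega>. \<Sum>j\<in>UNIV. prob {\<omega> \<in> space M. J k \<omega> = j} * f j (H \<omega>))"
    by (intro Bochner_Integration.integral_sum[symmetric] integrable_mult_right int)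
  finally show ?thesis
    unfolding H_def .
qed

text \<open>The state before selection \<open>k\<close> is a function of the earlier selections,
  hence independent of \<open>J k\<close>; averaging over \<open>J k\<close> first yields one factor
  \<open>c\<close>. The invariant set \<open>S\<close> is there because the contraction need not
  hold for all states.\<close>

lemma (in prob_space) expectation_random_iteration_le:
  fixes J :: "nat \<Rightarrow> 'a \<Rightarrow> 'b::finite" and D :: "nat \<Rightarrow> 'a \<Rightarrow> 'c" and V :: "'c \<Rightarrow> real"
  assumes indep: "indep_vars (\<lambda>_. count_space UNIV) J UNIV"
    and prob_J: "\<And>k j. prob {\<omega> \<in> space M. J k \<omega> = j} = p j"
    and D_0: "\<And>\<omega>. \<omega> \<in> space M \<Longrightarrow> D 0 \<omega> = d0"
    and D_Suc: "\<And>k \<omega>. \<omega> \<in> space M \<Longrightarrow> D (Suc k) \<omega> = step (J k \<omega>) (D k \<omega>)"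
    and inv_0: "d0 \<in> S"
    and inv_step: "\<And>j d. d \<in> S \<Longrightarrow> step j d \<in> S"
    and contraction: "\<And>d. d \<in> S \<Longrightarrow> (\<Sum>j\<in>UNIV. p j * V (step j d)) \<le> c * V d"
    and c: "0 \<le> c"
  shows "expectation (\<lambda>\<omega>. V (D k \<omega>)) \<le> c ^ k * V d0"
proof (induction k)
  case 0
  have "expectation (\<lambda>\<omega>. V (D 0 \<omega>)) = expectation (\<lambda>_. V d0)"
    by (intro Bochner_Integration.integral_cong) (auto simp: D_0)
  then show ?case by (simp add: prob_space)
next
  case (Suc k)
  \<comment> \<open>\<open>d\<close> replays the iteration along an arbitrary deterministic
    selection sequence, so the state becomes a function of the history alone.\<close>
  define d where "d = (\<lambda>n h. rec_nat d0 (\<lambda>i x. step (h i) x) n)"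
  have d_simps: "d 0 h = d0" "d (Suc i) h = step (h i) (d i h)" for i and h :: "nat \<Rightarrow> 'b"
    by (simp_all add: d_def)
  have d_cong: "d n h = d n h'" if "\<And>i. i < n \<Longrightarrow> h i = h' i" for n h h'
    using that by (induction n) (simp_all add: d_simps)
  have D_eq: "D n \<omega> = d n (\<lambda>i. J i \<omega>)" if "\<omega> \<in> space M" for n \<omega>
    using that by (induction n) (simp_all add: d_simps D_0 D_Suc)
  have d_inv: "d n h \<in> S" for n h
    by (induction n) (simp_all add: d_simps inv_0 inv_step)
  \<comment> \<open>Positions from \<open>k\<close> on hold \<open>undefined\<close>;
    \<open>d k\<close> reads only the earlier ones.\<close>
  define H where "H \<omega> = restrict (\<lambda>i. J i \<omega>) {..<k}" for \<omega>
  have D_H: "D k \<omega> = d k (H \<omega>)" if "\<omega> \<in> space M" for \<omega>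
    unfolding D_eq[OF that] by (rule d_cong) (simp add: H_def)
  have int: "integrable M (\<lambda>\<omega>. g (H \<omega>))" for g :: "(nat \<Rightarrow> 'b) \<Rightarrow> real"
    unfolding H_def using indep by (intro integrable_finite_history) (auto simp: indep_vars_def)
  have "expectation (\<lambda>\<omega>. V (D (Suc k) \<omega>)) = expectation (\<lambda>\<omega>. V (step (J k \<omega>) (d k (H \<omega>))))"
    by (intro Bochner_Integration.integral_cong) (simp_all add: D_Suc D_H)
  also have "\<dots> = expectation (\<lambda>\<omega>. \<Sum>j\<in>UNIV. p j * V (step j (d k (H \<omega>))))"
    unfolding H_def
    using expectation_independent_choice[OF indep, of "{..<k}" k "\<lambda>j h. V (step j (d k h))"] by (simp add: prob_J)
  also have "\<dots> \<le> expectation (\<lambda>\<omega>. c * V (d k (H \<omega>)))"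
    by (intro integral_mono int contraction d_inv)
  also have "\<dots> = c * expectation (\<lambda>\<omega>. V (D k \<omega>))"
    by (simp add: D_H cong: Bochner_Integration.integral_cong)
  also have "\<dots> \<le> c ^ Suc k * V d0"
    using mult_left_mono[OF Suc.IH c] by (simp add: mult.assoc)
  finally show ?case .
qed

section \<open>One-step contraction of A(X - A^+ B)\<close>

lemma norm_sq_eq_sum_column:
  fixes D :: "real^'p^'m"
  shows "(norm D)\<^sup>2 = (\<Sum>l\<in>UNIV. (norm (column l D))\<^sup>2)"
proof -
  have "(norm D)\<^sup>2 = (\<Sum>i\<in>UNIV. \<Sum>l\<in>UNIV. (D $ i $ l)\<^sup>2)"
    unfolding norm_matrix_eq_frobenius by (simp add: sum_nonneg)
  also have "\<dots> = (\<Sum>l\<in>UNIV. \<Sum>i\<in>UNIV. (D $ i $ l)\<^sup>2)"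
    by (rule sum.swap)
  also have "\<dots> = (\<Sum>l\<in>UNIV. (norm (column l D))\<^sup>2)"
    by (simp add: norm_vec_def L2_set_def sum_nonneg column_def)
  finally show ?thesis .
qed

lemma norm_sq_transpose_mult_vec:
  fixes A :: "real^'n^'m"
  shows "(norm (transpose A *v d))\<^sup>2 = (\<Sum>j\<in>UNIV. (column j A \<bullet> d)\<^sup>2)"
proof -
  have "(transpose A *v d) $ j = column j A \<bullet> d" for j
    by (simp add: vector_matrix_mult_def column_def inner_vec_def mult.commute)
  then show ?thesis
    by (simp add: norm_vec_def L2_set_def sum_nonneg del: transpose_matrix_vector)
qed

text \<open>Each column of \<open>D\<close> is projected onto the orthogonal complement of
  \<open>a\<close>; for \<open>a = 0\<close> the inverse of 0 is 0 and \<open>D\<close> is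
  unchanged.\<close>

definition residual_step :: "real^'m \<Rightarrow> real^'p^'m \<Rightarrow> real^'p^'m" where
  "residual_step a D = D - outer_prod a ((a v* D) /\<^sub>R (norm a)\<^sup>2)"

text \<open>Pythagoras for that projection. The factor ||a||^2, later supplied by the selection
  probability, clears the denominator and covers a = 0.\<close>

lemma norm_sq_column_residual_step:
  "(norm a)\<^sup>2 * (norm (column l (residual_step a D)))\<^sup>2
     = (norm a)\<^sup>2 * (norm (column l D))\<^sup>2 - (a \<bullet> column l D)\<^sup>2"
proof (cases "a = 0")
  case False
  have "column l (residual_step a D) = column l D - ((a \<bullet> column l D) / (norm a)\<^sup>2) *\<^sub>R a"
    by (simp add: residual_step_def outer_prod_def column_def vec_eq_iff vector_matrix_mult_def
        inner_vec_def field_simps)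
  then have "(norm (column l (residual_step a D)))\<^sup>2 = (norm (column l D))\<^sup>2
      - 2 * ((a \<bullet> column l D) / (norm a)\<^sup>2) * (a \<bullet> column l D) + ((a \<bullet> column l D) / (norm a)\<^sup>2)\<^sup>2 * (norm a)\<^sup>2"
    by (simp add: power2_norm_eq_inner inner_diff_left inner_diff_right inner_commute)
       (simp add: power2_eq_square)
  with False show ?thesis
    by (simp add: field_simps power2_eq_square)
qed simp

lemma matrix_mult_outer_prod:
  fixes A :: "real^'n^'m"
  shows "A ** outer_prod u w = outer_prod (A *v u) w"
  by (simp add: outer_prod_def vec_eq_iff matrix_matrix_mult_def matrix_vector_mult_def
      sum_distrib_right mult.assoc)

lemma matrix_diff_ldistrib:
  fixes A :: "'a::ring_1^'n^'m"
  shows "A ** (Y - Z) = A ** Y - A ** Z"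
  by (simp add: vec_eq_iff matrix_matrix_mult_def right_diff_distrib sum_subtractf)

text \<open>As A_{:,j} = A e_j, the correction factors through \<open>A\<close>; the step therefore
  keeps the columns in the range of \<open>A\<close>.\<close>

lemma residual_step_eq_mult:
  "residual_step (column j A) (A ** Y)
     = A ** (Y - outer_prod (axis j 1) ((column j A v* (A ** Y)) /\<^sub>R (norm (column j A))\<^sup>2))"
  by (simp add: residual_step_def matrix_diff_ldistrib matrix_mult_outer_prod matrix_vector_mult_basis)

lemma residual_step_contraction:
  fixes A :: "real^'n^'m" and Y :: "real^'p^'n"
  assumes "A \<noteq> 0"
  shows "(\<Sum>j\<in>UNIV. (norm (column j A))\<^sup>2 / (norm A)\<^sup>2 * (norm (residual_step (column j A) (A ** Y)))\<^sup>2)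
       \<le> (1 - (sigma_min A)\<^sup>2 / (norm A)\<^sup>2) * (norm (A ** Y))\<^sup>2" (is "?L \<le> _")
proof -
  let ?D = "A ** Y"
  have col: "column l ?D = A *v column l Y" for l
    by (simp add: column_def matrix_matrix_mult_def matrix_vector_mult_def)
  \<comment> \<open>Scaling by ||A||_F^2 turns the selection probabilities into the weights
    ||A_{:,j}||^2 of the Pythagoras identity, which is then summed over the columns of
    \<open>A ** Y\<close>.\<close>
  have "(norm A)\<^sup>2 * ?L
      = (\<Sum>j\<in>UNIV. \<Sum>l\<in>UNIV. (norm (column j A))\<^sup>2 * (norm (column l (residual_step (column j A) ?D)))\<^sup>2)"
    using assms by (simp add: sum_distrib_left norm_sq_eq_sum_column[of "residual_step _ _"])
  also have "\<dots> = (\<Sum>l\<in>UNIV. \<Sum>j\<in>UNIV. (norm (column j A))\<^sup>2 * (norm (column l ?D))\<^sup>2 - (column j A \<bullet> column l ?D)\<^sup>2)"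
    unfolding norm_sq_column_residual_step by (rule sum.swap)
  also have "\<dots> = (\<Sum>l\<in>UNIV. (norm A)\<^sup>2 * (norm (column l ?D))\<^sup>2 - (norm (transpose A *v column l ?D))\<^sup>2)"
    unfolding norm_sq_transpose_mult_vec norm_sq_eq_sum_column[of A] by (simp add: sum_subtractf sum_distrib_right)
  also have "\<dots> \<le> (\<Sum>l\<in>UNIV. (norm A)\<^sup>2 * (norm (column l ?D))\<^sup>2 - (sigma_min A)\<^sup>2 * (norm (column l ?D))\<^sup>2)"
    unfolding col using sigma_min_bound[OF assms] by (intro sum_mono diff_left_mono) auto
  also have "\<dots> = (norm A)\<^sup>2 * ((1 - (sigma_min A)\<^sup>2 / (norm A)\<^sup>2) * (norm ?D)\<^sup>2)"
    using assms unfolding norm_sq_eq_sum_column[of ?D]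
    by (simp add: sum_subtractf field_simps flip: sum_distrib_left)
  finally show ?thesis
    using assms by simp
qed

text \<open>With Y the identity, the contraction bounds a sum of nonnegative terms by the factor
  times ||A||_F^2 > 0. The sign allows the induction hypothesis to be multiplied by the
  factor.\<close>

lemma contraction_factor_nonneg:
  fixes A :: "real^'n^'m"
  assumes "A \<noteq> 0"
  shows "0 \<le> 1 - (sigma_min A)\<^sup>2 / (norm A)\<^sup>2"
proof -
  have "0 \<le> (\<Sum>j\<in>UNIV. (norm (column j A))\<^sup>2 / (norm A)\<^sup>2 * (norm (residual_step (column j A) (A ** mat 1)))\<^sup>2)"
    by (intro sum_nonneg) simp
  also have "\<dots> \<le> (1 - (sigma_min A)\<^sup>2 / (norm A)\<^sup>2) * (norm A)\<^sup>2"
    using residual_step_contraction[OF assms, of "mat 1"] by simp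
  finally show ?thesis
    using assms by (simp add: zero_le_mult_iff)
qed

section \<open>Convergence of the randomized iteration\<close>

theorem theorem3p1:
  fixes A :: "real^'n^'m" and B :: "real^'p^'m" and X0 :: "real^'p^'n"
    and M :: "'w measure"
    and J :: "nat \<Rightarrow> 'w \<Rightarrow> 'n"
    and X :: "nat \<Rightarrow> 'w \<Rightarrow> real^'p^'n"
    and R :: "nat \<Rightarrow> 'w \<Rightarrow> real^'p^'m"
    and W :: "nat \<Rightarrow> 'w \<Rightarrow> real^'p"
  assumes "A \<noteq> 0"
    and "prob_space M"
    and "prob_space.indep_vars M (\<lambda>_. count_space UNIV) J UNIV"
    and "\<And>k j. measure M {\<omega> \<in> space M. J k \<omega> = j} = (norm (column j A))\<^sup>2 / (norm A)\<^sup>2"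
    and "\<And>\<omega>. \<omega> \<in> space M \<Longrightarrow> X 0 \<omega> = X0"
    and "\<And>\<omega>. \<omega> \<in> space M \<Longrightarrow> R 0 \<omega> = B - A ** X0"
    and "\<And>k \<omega>. \<omega> \<in> space M \<Longrightarrow>
           W k \<omega> = (column (J k \<omega>) A v* R k \<omega>) /\<^sub>R (norm (column (J k \<omega>) A))\<^sup>2"
    and "\<And>k \<omega>. \<omega> \<in> space M \<Longrightarrow>
           row (J k \<omega>) (X (Suc k) \<omega>) = row (J k \<omega>) (X k \<omega>) + W k \<omega>"
    and "\<And>k \<omega> i. \<omega> \<in> space M \<Longrightarrow> i \<noteq> J k \<omega> \<Longrightarrow>
           row i (X (Suc k) \<omega>) = row i (X k \<omega>)"
    and "\<And>k \<omega>. \<omega> \<in> space M \<Longrightarrow>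
           R (Suc k) \<omega> = R k \<omega> - outer_prod (column (J k \<omega>) A) (W k \<omega>)"
  shows "\<forall>k. prob_space.expectation M (\<lambda>\<omega>. (norm (A ** (X k \<omega> - pinv A ** B)))\<^sup>2)
           \<le> (1 - (sigma_min A)\<^sup>2 / (norm A)\<^sup>2) ^ k * (norm (A ** (X0 - pinv A ** B)))\<^sup>2"
proof
  fix k
  interpret prob_space M by fact
  let ?P = "pinv A ** B"
  \<comment> \<open>The two row conditions combine into one rank-one update of
    \<open>X\<close>.\<close>
  have X_Suc: "X (Suc k) \<omega> = X k \<omega> + outer_prod (axis (J k \<omega>) 1) (W k \<omega>)" if "\<omega> \<in> space M" for k \<omega>
  proof -
    have "X (Suc k) \<omega> $ i $ l = (X k \<omega> + outer_prod (axis (J k \<omega>) 1) (W k \<omega>)) $ i $ l" for i l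
      using arg_cong[OF assms(8)[OF that, of k], of "\<lambda>x. x $ l"] 
        arg_cong[OF assms(9)[OF that, of i k], of "\<lambda>x. x $ l"]
      by (cases "i = J k \<omega>") (simp_all add: row_def outer_prod_def axis_def)
    then show ?thesis by (simp add: vec_eq_iff)
  qed
  \<comment> \<open>The recursion for \<open>R\<close> tracks the true residual because A e_j =
    A_{:,j}.\<close>
  have R_eq: "R k \<omega> = B - A ** X k \<omega>" if "\<omega> \<in> space M" for k \<omega>
    using that by (induction k) (simp_all add: assms(5,6,10) X_Suc matrix_add_ldistrib matrix_mult_outer_prod matrix_vector_mult_basis)
  have col_mult: "column j A v* Z = row j (transpose A ** Z)" for j and Z :: "real^'p^'m"
    by (simp add: vec_eq_iff row_def column_def vector_matrix_mult_def matrix_matrix_mult_def transpose_def mult.commute)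
  \<comment> \<open>The least-squares residual is orthogonal to every column of \<open>A\<close>, so
    the inconsistent part of \<open>B\<close> never enters \<open>W\<close>.\<close>
  have normal: "column j A v* (B - A ** ?P) = 0" for j
  proof -
    have "column j A v* (A ** ?P) = column j A v* B"
      unfolding col_mult by (metis matrix_mul_assoc transpose_mult_pinv)
    then show ?thesis by (simp add: vector_matrix_mult_diff_rdistrib)
  qed
  define D where "D k \<omega> = A ** (X k \<omega> - ?P)" for k \<omega>
  \<comment> \<open>Since R = (B - A A^+ B) - D, \<open>W\<close> is computed from -D alone; the
    sign flip makes adding \<open>W\<close> to \<open>X\<close> remove from \<open>D\<close> its
    component along the selected column.\<close>
  have D_Suc: "D (Suc k) \<omega> = residual_step (column (J k \<omega>) A) (D k \<omega>)" if "\<omega> \<in> space M" for k \<omega>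
  proof -
    let ?a = "column (J k \<omega>) A"
    have "R k \<omega> = (B - A ** ?P) - D k \<omega>"
      by (simp add: R_eq that D_def matrix_diff_ldistrib)
    then have "?a v* R k \<omega> = - (?a v* D k \<omega>)"
      by (simp add: vector_matrix_mult_diff_rdistrib[of _ "B - A ** ?P"] normal)
    then have "W k \<omega> = - ((?a v* D k \<omega>) /\<^sub>R (norm ?a)\<^sup>2)"
      by (simp add: assms(7)[OF that])
    moreover have "outer_prod ?a (- w) = - outer_prod ?a w" for w :: "real^'p"
      by (simp add: outer_prod_def vec_eq_iff)
    ultimately show ?thesis
      by (simp add: D_def residual_step_def X_Suc[OF that] matrix_diff_ldistrib
          matrix_add_ldistrib matrix_mult_outer_prod matrix_vector_mult_basis)
  qed
  have "expectation (\<lambda>\<omega>. (norm (D k \<omega>))\<^sup>2)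
      \<le> (1 - (sigma_min A)\<^sup>2 / (norm A)\<^sup>2) ^ k * (norm (A ** (X0 - ?P)))\<^sup>2"
  \<comment> \<open>The range of left multiplication by \<open>A\<close> is the invariant set: it
    contains the initial \<open>D\<close>, and \<open>sigma_min_bound\<close> applies to the columns
    of its members.\<close>
  proof (rule expectation_random_iteration_le[where S = "range ((**) A)"
        and step = "\<lambda>j. residual_step (column j A)" and V = "\<lambda>d. (norm d)\<^sup>2"])
    show "residual_step (column j A) d \<in> range ((**) A)" if "d \<in> range ((**) A)" for j and d :: "real^'p^'m"
      using that by (auto simp: residual_step_eq_mult)
    show "(\<Sum>j\<in>UNIV. (norm (column j A))\<^sup>2 / (norm A)\<^sup>2 * (norm (residual_step (column j A) d))\<^sup>2)
        \<le> (1 - (sigma_min A)\<^sup>2 / (norm A)\<^sup>2) * (norm d)\<^sup>2" if "d \<in> range ((**) A)" for d :: "real^'p^'m"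
      using that residual_step_contraction[OF assms(1)] by auto
  qed (use assms(3-5) D_Suc contraction_factor_nonneg[OF assms(1)] in \<open>simp_all add: D_def\<close>)
  then show "expectation (\<lambda>\<omega>. (norm (A ** (X k \<omega> - ?P)))\<^sup>2)
      \<le> (1 - (sigma_min A)\<^sup>2 / (norm A)\<^sup>2) ^ k * (norm (A ** (X0 - ?P)))\<^sup>2"
    unfolding D_def .
qed

end
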